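(* Let $q\ge1$ be an integer and let $a,b$ be real numbers with $b\neq0$ and $b(q+1)-a\ge2|b|\sqrt q$. For a fixed time $t\in\mathbb N_0$, $$\lim_{r\to\infty}W_{q+1}^{a,b}(r;t)=0\qquad\text{and}\qquad\lim_{r\to\infty}V_{q+1}^{a,b}(r;t)=0.$$
   Context: $T_{q+1}$ is the $(q+1)$-regular tree with a fixed root $x_0$ and graph distance $d$. $\Delta_{T_{q+1}}f(x)=(q+1)f(x)-\sum_{y\sim x}f(y)$ and $\Delta_{q+1}^{a,b}=b\Delta_{T_{q+1}}-aI$, acting in the space variable. $\partial_tf(t)=f(t+1)-f(t)$ and $\partial_t^2f(t)=f(t+2)-2f(t+1)+f(t)$ for $t\in\mathbb N_0$. Wave kernels: $W_{q+1}^{a,b}$ and $V_{q+1}^{a,b}$ are the solutions of $\Delta_{q+1}^{a,b}U(x;t)+\partial_t^2U(x;t)=0$ ($x\in V(T_{q+1})$, $t\in\mathbb N_0$) with, for all $x$, $W_{q+1}^{a,b}(x;0)=\delta_{x_0}(x)$, $\partial_tW_{q+1}^{a,b}(x;0)=0$, respectively $V_{q+1}^{a,b}(x;0)=0$, $\partial_tV_{q+1}^{a,b}(x;0)=\delta_{x_0}(x)$, where $\delta_{x_0}(x)=1$ if $x=x_0$ and $0$ otherwise. They depend on $x$ only through $r=d(x_0,x)\in\mathbb N_0$ and are written $W_{q+1}^{a,b}(r;t)$, $V_{q+1}^{a,b}(r;t)$. *)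

theory Defs
  imports Complex_Main
begin

text \<open>Graphs are adjacency relations on a vertex type: every element of \<open>'v\<close> is a vertex.\<close>

definition simple_graph :: "('v \<Rightarrow> 'v \<Rightarrow> bool) \<Rightarrow> bool" where
  "simple_graph adj \<longleftrightarrow> symp adj \<and> irreflp adj"

definition connected_graph :: "('v \<Rightarrow> 'v \<Rightarrow> bool) \<Rightarrow> bool" where
  "connected_graph adj \<longleftrightarrow> (\<forall>x y. adj\<^sup>*\<^sup>* x y)"

definition graph_cycle :: "('v \<Rightarrow> 'v \<Rightarrow> bool) \<Rightarrow> 'v list \<Rightarrow> bool" where
  "graph_cycle adj xs \<longleftrightarrow>
     3 \<le> length xs \<and> distinct xs \<and> successively adj xs \<and> adj (last xs) (hd xs)"

definition tree :: "('v \<Rightarrow> 'v \<Rightarrow> bool) \<Rightarrow> bool" where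
  "tree adj \<longleftrightarrow> simple_graph adj \<and> connected_graph adj \<and> (\<nexists>xs. graph_cycle adj xs)"

definition regular_graph :: "nat \<Rightarrow> ('v \<Rightarrow> 'v \<Rightarrow> bool) \<Rightarrow> bool" where
  "regular_graph k adj \<longleftrightarrow> (\<forall>x. finite {y. adj x y} \<and> card {y. adj x y} = k)"

definition graph_dist :: "('v \<Rightarrow> 'v \<Rightarrow> bool) \<Rightarrow> 'v \<Rightarrow> 'v \<Rightarrow> nat" where
  "graph_dist adj x y = (LEAST n. (adj ^^ n) x y)"

definition laplacian :: "('v \<Rightarrow> 'v \<Rightarrow> bool) \<Rightarrow> nat \<Rightarrow> ('v \<Rightarrow> real) \<Rightarrow> 'v \<Rightarrow> real" where
  "laplacian adj q f x = (real q + 1) * f x - (\<Sum>y | adj x y. f y)"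

definition laplacian_ab ::
    "('v \<Rightarrow> 'v \<Rightarrow> bool) \<Rightarrow> nat \<Rightarrow> real \<Rightarrow> real \<Rightarrow> ('v \<Rightarrow> real) \<Rightarrow> 'v \<Rightarrow> real" where
  "laplacian_ab adj q a b f x = b * laplacian adj q f x - a * f x"

definition time_diff :: "(nat \<Rightarrow> real) \<Rightarrow> nat \<Rightarrow> real" where
  "time_diff f t = f (t + 1) - f t"

definition time_diff2 :: "(nat \<Rightarrow> real) \<Rightarrow> nat \<Rightarrow> real" where
  "time_diff2 f t = f (t + 2) - 2 * f (t + 1) + f t"

definition delta_fun :: "'v \<Rightarrow> 'v \<Rightarrow> real" where
  "delta_fun x0 x = (if x = x0 then 1 else 0)"

definition wave_solution ::
    "('v \<Rightarrow> 'v \<Rightarrow> bool) \<Rightarrow> nat \<Rightarrow> real \<Rightarrow> real \<Rightarrow> ('v \<Rightarrow> real) \<Rightarrow> ('v \<Rightarrow> real) \<Rightarrow>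
       ('v \<Rightarrow> nat \<Rightarrow> real) \<Rightarrow> bool" where
  "wave_solution adj q a b f g U \<longleftrightarrow>
     (\<forall>x t. laplacian_ab adj q a b (\<lambda>y. U y t) x + time_diff2 (U x) t = 0) \<and>
     (\<forall>x. U x 0 = f x) \<and> (\<forall>x. time_diff (U x) 0 = g x)"

text \<open>The definite descriptions below are well-defined, by \<open>wave_solution_ex1\<close>,
  \<open>wave_W_radial\<close> and \<open>wave_V_radial\<close>.\<close>

definition vertex_W ::
    "('v \<Rightarrow> 'v \<Rightarrow> bool) \<Rightarrow> 'v \<Rightarrow> nat \<Rightarrow> real \<Rightarrow> real \<Rightarrow> 'v \<Rightarrow> nat \<Rightarrow> real" where
  "vertex_W adj x0 q a b = (THE U. wave_solution adj q a b (delta_fun x0) (\<lambda>_. 0) U)"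

definition vertex_V ::
    "('v \<Rightarrow> 'v \<Rightarrow> bool) \<Rightarrow> 'v \<Rightarrow> nat \<Rightarrow> real \<Rightarrow> real \<Rightarrow> 'v \<Rightarrow> nat \<Rightarrow> real" where
  "vertex_V adj x0 q a b = (THE U. wave_solution adj q a b (\<lambda>_. 0) (delta_fun x0) U)"

text \<open>The common value of a radial function on the sphere of radius \<open>r\<close> around \<open>x0\<close>.\<close>

definition radial_value :: "('v \<Rightarrow> 'v \<Rightarrow> bool) \<Rightarrow> 'v \<Rightarrow> ('v \<Rightarrow> real) \<Rightarrow> nat \<Rightarrow> real" where
  "radial_value adj x0 f r = (THE c. \<forall>x. graph_dist adj x0 x = r \<longrightarrow> f x = c)"

definition wave_W ::
    "('v \<Rightarrow> 'v \<Rightarrow> bool) \<Rightarrow> 'v \<Rightarrow> nat \<Rightarrow> real \<Rightarrow> real \<Rightarrow> nat \<Rightarrow> nat \<Rightarrow> real" where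
  "wave_W adj x0 q a b r t = radial_value adj x0 (\<lambda>x. vertex_W adj x0 q a b x t) r"

definition wave_V ::
    "('v \<Rightarrow> 'v \<Rightarrow> bool) \<Rightarrow> 'v \<Rightarrow> nat \<Rightarrow> real \<Rightarrow> real \<Rightarrow> nat \<Rightarrow> nat \<Rightarrow> real" where
  "wave_V adj x0 q a b r t = radial_value adj x0 (\<lambda>x. vertex_V adj x0 q a b x t) r"

lemma wave_solution_ex1:
  fixes adj :: "'v \<Rightarrow> 'v \<Rightarrow> bool"
  shows "\<exists>!U. wave_solution adj q a b f g U"
proof (rule ex_ex1I)
  define step where "step = (\<lambda>p :: ('v \<Rightarrow> real) \<times> ('v \<Rightarrow> real).
    (snd p, \<lambda>x. 2 * snd p x - fst p x - laplacian_ab adj q a b (fst p) x))"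
  define P where "P t = (step ^^ t) (f, \<lambda>x. f x + g x)" for t
  define U where "U x t = fst (P t) x" for x t
  have P0: "P 0 = (f, \<lambda>x. f x + g x)" and PS: "P (Suc t) = step (P t)" for t
    by (simp_all add: P_def)
  have fS: "fst (P (Suc t)) = snd (P t)" for t by (simp add: PS step_def)
  have sS: "snd (P (Suc t)) = (\<lambda>x. 2 * snd (P t) x - fst (P t) x
      - laplacian_ab adj q a b (fst (P t)) x)" for t by (simp add: PS step_def)
  have "(\<lambda>y. U y t) = fst (P t)" for t by (simp add: U_def)
  hence "wave_solution adj q a b f g U"
    by (simp add: wave_solution_def time_diff_def time_diff2_def U_def fS sS P0)
  thus "\<exists>U. wave_solution adj q a b f g U" by blast
next
  fix U U' assume A: "wave_solution adj q a b f g U" "wave_solution adj q a b f g U'"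
  have "(\<lambda>y. U y t) = (\<lambda>y. U' y t) \<and> (\<lambda>y. U y (Suc t)) = (\<lambda>y. U' y (Suc t))" for t
  proof (induction t)
    case 0
    have "U x 0 = U' x 0 \<and> U x (Suc 0) = U' x (Suc 0)" for x
    proof -
      have "U x 0 = f x" "U' x 0 = f x" "time_diff (U x) 0 = g x" "time_diff (U' x) 0 = g x"
        using A by (simp_all add: wave_solution_def)
      thus ?thesis by (simp add: time_diff_def)
    qed
    thus ?case by simp
  next
    case (Suc t)
    have "U x (t + 2) = U' x (t + 2)" for x
    proof -
      have "laplacian_ab adj q a b (\<lambda>y. U y t) x + time_diff2 (U x) t
          = laplacian_ab adj q a b (\<lambda>y. U' y t) x + time_diff2 (U' x) t"
        using A by (simp add: wave_solution_def)
      moreover have "U x t = U' x t" "U x (Suc t) = U' x (Suc t)"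
        using Suc by metis+
      moreover have "(\<lambda>y. U y t) = (\<lambda>y. U' y t)" using Suc by blast
      ultimately show ?thesis by (simp add: time_diff2_def)
    qed
    thus ?case using Suc by (simp add: numeral_2_eq_2)
  qed
  thus "U = U'" by (intro ext) metis
qed

lemma vertex_W_solution:
  "wave_solution adj q a b (delta_fun x0) (\<lambda>_. 0) (vertex_W adj x0 q a b)"
  unfolding vertex_W_def by (rule theI'[OF wave_solution_ex1])

lemma vertex_V_solution:
  "wave_solution adj q a b (\<lambda>_. 0) (delta_fun x0) (vertex_V adj x0 q a b)"
  unfolding vertex_V_def by (rule theI'[OF wave_solution_ex1])

lemma rtranclp_distinct_path:
  assumes "R\<^sup>*\<^sup>* x y"
  shows "\<exists>xs. xs \<noteq> [] \<and> hd xs = x \<and> last xs = y \<and> distinct xs \<and> successively R xs"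
  using assms
proof (induction rule: converse_rtranclp_induct)
  case base
  show ?case by (rule exI[of _ "[y]"]) simp
next
  case (step x z)
  then obtain xs where xs: "xs \<noteq> []" "hd xs = z" "last xs = y" "distinct xs" "successively R xs"
    by blast
  show ?case
  proof (cases "x \<in> set xs")
    case True
    then obtain ys zs where "xs = ys @ x # zs" by (meson split_list)
    with xs show ?thesis
      by (intro exI[of _ "x # zs"]) (auto simp: successively_append_iff)
  next
    case False
    with xs step(1) show ?thesis
      by (intro exI[of _ "x # xs"]) (auto simp: successively_Cons)
  qed
qed

lemma graph_dist_relpowp:
  assumes "connected_graph adj" shows "(adj ^^ graph_dist adj x y) x y"
proof -
  have "adj\<^sup>*\<^sup>* x y" using assms by (simp add: connected_graph_def)
  hence "\<exists>n. (adj ^^ n) x y" by (rule rtranclp_imp_relpowp)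
  thus ?thesis unfolding graph_dist_def by (rule LeastI_ex)
qed

lemma graph_dist_le: "(adj ^^ n) x y \<Longrightarrow> graph_dist adj x y \<le> n"
  unfolding graph_dist_def by (rule Least_le)

lemma graph_dist_self [simp]: "graph_dist adj x x = 0"
  using graph_dist_le[of 0 adj x x] by simp

lemma graph_dist_eq_0:
  "connected_graph adj \<Longrightarrow> graph_dist adj x y = 0 \<Longrightarrow> x = y"
  using graph_dist_relpowp[of adj x y] by simp

lemma graph_dist_adj:
  assumes "connected_graph adj" "adj y z"
  shows "graph_dist adj x z \<le> Suc (graph_dist adj x y)"
  using graph_dist_relpowp[OF assms(1), of x y] assms(2) by (intro graph_dist_le) auto

lemma graph_dist_parent:
  assumes "connected_graph adj" "graph_dist adj x y = Suc n"
  shows "\<exists>z. adj z y \<and> graph_dist adj x z = n"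
proof -
  have "(adj ^^ Suc n) x y" using graph_dist_relpowp[OF assms(1), of x y] assms(2) by simp
  then obtain z where z: "(adj ^^ n) x z" "adj z y" by auto
  have "graph_dist adj x z \<le> n" using graph_dist_le[OF z(1)] .
  moreover have "Suc n \<le> Suc (graph_dist adj x z)"
    using graph_dist_adj[OF assms(1) z(2), of x] assms(2) by simp
  ultimately show ?thesis using z by auto
qed

lemma tree_unique_lower_neighbour:
  assumes "tree adj" "adj x y" "adj x y'"
    "graph_dist adj x0 y \<le> graph_dist adj x0 x" "graph_dist adj x0 y' \<le> graph_dist adj x0 x"
  shows "y = y'"
proof (rule ccontr)
  assume ne: "y \<noteq> y'"
  have conn: "connected_graph adj" and sy: "\<And>u v. adj u v \<Longrightarrow> adj v u"
    and ir: "\<And>u. \<not> adj u u"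
    using assms(1) by (auto simp: tree_def simple_graph_def dest: sympD irreflpD)
  define R where "R u v \<longleftrightarrow> adj u v \<and> u \<noteq> x \<and> v \<noteq> x" for u v
  have toroot: "R\<^sup>*\<^sup>* z x0" if "z \<noteq> x" "graph_dist adj x0 z \<le> graph_dist adj x0 x" for z
    using that
  proof (induction "graph_dist adj x0 z" arbitrary: z)
    case 0
    thus ?case using graph_dist_eq_0[OF conn, of x0 z] by simp
  next
    case (Suc n)
    obtain w where w: "adj w z" "graph_dist adj x0 w = n"
      using graph_dist_parent[OF conn Suc(2)[symmetric]] by blast
    have "w \<noteq> x" using Suc w by auto
    hence "R z w" "R\<^sup>*\<^sup>* w x0" using Suc w sy by (auto simp: R_def)
    thus ?case by (rule converse_rtranclp_into_rtranclp)
  qed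
  have "symp R" using sy by (auto simp: R_def symp_def)
  hence symR: "R\<^sup>*\<^sup>* u v \<Longrightarrow> R\<^sup>*\<^sup>* v u" for u v by (metis symp_rtranclp sympD)
  have yx: "y \<noteq> x" "y' \<noteq> x" using assms ir by auto
  have "R\<^sup>*\<^sup>* y x0" "R\<^sup>*\<^sup>* x0 y'" using toroot yx assms symR by blast+
  hence "R\<^sup>*\<^sup>* y y'" by (rule rtranclp_trans)
  then obtain xs where xs: "xs \<noteq> []" "hd xs = y" "last xs = y'" "distinct xs" "successively R xs"
    using rtranclp_distinct_path by metis
  have len: "2 \<le> length xs" using xs ne by (cases xs; cases "tl xs") auto
  have "x \<notin> set zs" if "successively R zs" "2 \<le> length zs" for zs
    using that
  proof (induction zs)
    case (Cons z zs)
    thus ?case by (cases zs; cases "tl zs") (auto simp: R_def)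
  qed simp
  hence nx: "x \<notin> set xs" using xs len by blast
  have "successively adj xs" using xs(5) by (rule successively_mono) (auto simp: R_def)
  hence "graph_cycle adj (x # xs)"
    using xs len nx assms sy by (auto simp: graph_cycle_def successively_Cons)
  thus False using assms(1) by (auto simp: tree_def)
qed

lemma sum_neighbours_radial:
  assumes "tree adj" "regular_graph (q + 1) adj" "\<And>y. f y = F (graph_dist adj x0 y)"
  shows "(\<Sum>y | adj x y. f y) =
    (case graph_dist adj x0 x of
       0 \<Rightarrow> (real q + 1) * F 1 | Suc n \<Rightarrow> F n + real q * F (Suc (Suc n)))"
proof -
  have conn: "connected_graph adj" and sy: "\<And>u v. adj u v \<Longrightarrow> adj v u"
    and ir: "\<And>u. \<not> adj u u"
    using assms(1) by (auto simp: tree_def simple_graph_def dest: sympD irreflpD)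
  have fin: "finite {y. adj x y}" and crd: "card {y. adj x y} = q + 1"
    using assms(2) by (auto simp: regular_graph_def)
  show ?thesis
  proof (cases "graph_dist adj x0 x")
    case 0
    have "f y = F 1" if "adj x y" for y
    proof -
      have "graph_dist adj x0 y \<le> 1" using graph_dist_adj[OF conn that, of x0] 0 by simp
      moreover have "graph_dist adj x0 y \<noteq> 0"
        using graph_dist_eq_0[OF conn] 0 that ir by metis
      ultimately have "graph_dist adj x0 y = 1" by simp
      thus ?thesis using assms(3) by simp
    qed
    hence "(\<Sum>y | adj x y. f y) = (\<Sum>y | adj x y. F 1)" by (intro sum.cong) auto
    thus ?thesis using 0 crd by simp
  next
    case (Suc n)
    obtain p where p: "adj p x" "graph_dist adj x0 p = n"
      using graph_dist_parent[OF conn Suc] by blast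
    have far: "f y = F (Suc (Suc n))" if "adj x y" "y \<noteq> p" for y
    proof -
      have "\<not> graph_dist adj x0 y \<le> graph_dist adj x0 x"
        using tree_unique_lower_neighbour[OF assms(1) that(1) sy[OF p(1)], of x0] that p Suc
        by auto
      hence "graph_dist adj x0 y = Suc (Suc n)"
        using graph_dist_adj[OF conn that(1), of x0] Suc by simp
      thus ?thesis using assms(3) by simp
    qed
    have "(\<Sum>y | adj x y. f y) = f p + (\<Sum>y \<in> {y. adj x y} - {p}. f y)"
      using fin sy[OF p(1)] by (intro sum.remove) auto
    also have "(\<Sum>y \<in> {y. adj x y} - {p}. f y) = (\<Sum>y \<in> {y. adj x y} - {p}. F (Suc (Suc n)))"
      using far by (intro sum.cong) auto
    also have "\<dots> = real q * F (Suc (Suc n))"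
      using fin crd sy[OF p(1)] by simp
    finally show ?thesis using Suc p assms(3) by simp
  qed
qed

lemma sphere_nonempty:
  assumes "tree adj" "regular_graph (q + 1) adj" "1 \<le> q"
  shows "\<exists>x. graph_dist adj x0 x = r"
proof (induction r)
  case 0
  show ?case by (rule exI[of _ x0]) simp
next
  case (Suc n)
  then obtain x where x: "graph_dist adj x0 x = n" by blast
  have conn: "connected_graph adj" using assms(1) by (auto simp: tree_def)
  have crd: "card {y. adj x y} = q + 1"
    using assms(2) by (auto simp: regular_graph_def)
  show ?case
  proof (rule ccontr)
    assume none: "\<nexists>x. graph_dist adj x0 x = Suc n"
    have "graph_dist adj x0 y \<le> graph_dist adj x0 x" if "adj x y" for y
      using graph_dist_adj[OF conn that, of x0] none x by (metis le_SucE)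
    hence "y = y'" if "adj x y" "adj x y'" for y y'
      using tree_unique_lower_neighbour[OF assms(1) that, of x0] that by blast
    moreover have "finite {y. adj x y}" using assms(2) by (simp add: regular_graph_def)
    ultimately have "card {y. adj x y} \<le> Suc 0"
      by (simp add: card_le_Suc0_iff_eq)
    thus False using crd assms(3) by simp
  qed
qed

lemma radial_value_eq:
  assumes "tree adj" "regular_graph (q + 1) adj" "1 \<le> q"
    and "\<And>x. f x = F (graph_dist adj x0 x)"
  shows "radial_value adj x0 f r = F r"
  unfolding radial_value_def using assms(4) sphere_nonempty[OF assms(1-3), of x0 r]
  by (intro the_equality) auto

lemma wave_solution_radial:
  assumes "tree adj" "regular_graph (q + 1) adj"
    and sol: "wave_solution adj q a b f g U"
    and f: "\<And>x. f x = F (graph_dist adj x0 x)" and g: "\<And>x. g x = G (graph_dist adj x0 x)"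
  shows "\<exists>H. \<forall>x. U x t = H (graph_dist adj x0 x)"
proof -
  have "(\<exists>H. \<forall>x. U x t = H (graph_dist adj x0 x)) \<and>
        (\<exists>H. \<forall>x. U x (Suc t) = H (graph_dist adj x0 x))"
  proof (induction t)
    case 0
    have 0: "U x 0 = F (graph_dist adj x0 x)" for x
      using sol f by (simp add: wave_solution_def)
    have 1: "U x (Suc 0) = F (graph_dist adj x0 x) + G (graph_dist adj x0 x)" for x
    proof -
      have "time_diff (U x) 0 = g x" using sol by (simp add: wave_solution_def)
      thus ?thesis using 0[of x] g[of x] by (simp add: time_diff_def)
    qed
    show ?case
      by (intro conjI exI[of _ F] exI[of _ "\<lambda>r. F r + G r"] allI 0 1)
  next
    case (Suc t)
    then obtain H K where H: "\<And>x. U x t = H (graph_dist adj x0 x)"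
      and K: "\<And>x. U x (Suc t) = K (graph_dist adj x0 x)" by blast
    define L where "L r = 2 * K r - H r - (b * ((real q + 1) * H r -
      (case r of 0 \<Rightarrow> (real q + 1) * H 1 | Suc n \<Rightarrow> H n + real q * H (Suc (Suc n)))) - a * H r)"
      for r
    have "U x (Suc (Suc t)) = L (graph_dist adj x0 x)" for x
    proof -
      have "laplacian_ab adj q a b (\<lambda>y. U y t) x + time_diff2 (U x) t = 0"
        using sol by (simp add: wave_solution_def)
      thus ?thesis
        using sum_neighbours_radial[OF assms(1,2), of "\<lambda>y. U y t" H x0 x, OF H]
        by (simp add: laplacian_ab_def laplacian_def time_diff2_def L_def H K)
    qed
    with K show ?case by blast
  qed
  thus ?thesis by blast
qed

lemma delta_fun_radial:
  assumes "tree adj"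
  shows "delta_fun x0 x = (if graph_dist adj x0 x = 0 then 1 else 0)"
  using assms graph_dist_eq_0[of adj x0 x] by (auto simp: delta_fun_def tree_def)

lemma wave_W_radial:
  assumes "tree adj" "regular_graph (q + 1) adj" "1 \<le> q"
  shows "vertex_W adj x0 q a b x t = wave_W adj x0 q a b (graph_dist adj x0 x) t"
proof -
  have "\<exists>H. \<forall>x. vertex_W adj x0 q a b x t = H (graph_dist adj x0 x)"
    by (rule wave_solution_radial[OF assms(1,2) vertex_W_solution,
          where F = "\<lambda>r. if r = 0 then 1 else 0" and G = "\<lambda>_. 0"])
       (simp_all add: delta_fun_radial[OF assms(1)])
  then obtain H where H: "\<And>x. vertex_W adj x0 q a b x t = H (graph_dist adj x0 x)" by blast
  show ?thesis unfolding wave_W_def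
    by (simp add: radial_value_eq[OF assms, where F = H] H)
qed

lemma wave_V_radial:
  assumes "tree adj" "regular_graph (q + 1) adj" "1 \<le> q"
  shows "vertex_V adj x0 q a b x t = wave_V adj x0 q a b (graph_dist adj x0 x) t"
proof -
  have "\<exists>H. \<forall>x. vertex_V adj x0 q a b x t = H (graph_dist adj x0 x)"
    by (rule wave_solution_radial[OF assms(1,2) vertex_V_solution,
          where F = "\<lambda>_. 0" and G = "\<lambda>r. if r = 0 then 1 else 0"])
       (simp_all add: delta_fun_radial[OF assms(1)])
  then obtain H where H: "\<And>x. vertex_V adj x0 q a b x t = H (graph_dist adj x0 x)" by blast
  show ?thesis unfolding wave_V_def
    by (simp add: radial_value_eq[OF assms, where F = H] H)
qed

end

theory Submission
  imports Defs
begin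

text \<open>At a fixed time both kernels have finite support, so the limits hold because the sequences
  are eventually zero. The recursion expresses the value of a solution at \<open>x\<close> and time \<open>t + 2\<close> through
  its value at \<open>x\<close> at time \<open>t + 1\<close> and its values at \<open>x\<close> and the neighbours of \<open>x\<close> at time \<open>t\<close>: two
  units of time move the support outwards by at most one edge. Data concentrated at the root
  therefore vanish beyond distance \<open>t div 2\<close> at time \<open>t\<close> (\<open>wave_solution_finite_speed\<close>), and
  radiality carries this over from vertices to radii, since every sphere is nonempty.\<close>

text \<open>The speed one half comes from the Laplacian acting at the earliest of the three times
  of the second difference: a vertex outside the ball of radius \<open>N + 1\<close> has all its neighbours outside
  the ball of radius \<open>N\<close>. The values at times \<open>0\<close> and \<open>1\<close> are \<open>f\<close> and \<open>f + g\<close>, both supported in the ball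
  of radius \<open>R\<close>.\<close>

lemma wave_solution_finite_speed:
  assumes conn: "connected_graph adj" and sym: "symp adj"
    and sol: "wave_solution adj q a b f g U"
    and f: "\<And>x. R < graph_dist adj x0 x \<Longrightarrow> f x = 0"
    and g: "\<And>x. R < graph_dist adj x0 x \<Longrightarrow> g x = 0"
  shows "R + t div 2 < graph_dist adj x0 x \<Longrightarrow> U x t = 0"
proof (induction t arbitrary: x rule: induct_nat_012)
  case 0
  thus ?case using sol f by (simp add: wave_solution_def)
next
  case 1
  have "U x 0 = f x" and "time_diff (U x) 0 = g x"
    using sol by (simp_all add: wave_solution_def)
  with 1 f g show ?case by (simp add: time_diff_def)
next
  case (ge2 t)
  have here: "U x t = 0" "U x (Suc t) = 0"
    using ge2 by simp_all
  have "U y t = 0" if "adj x y" for y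
  proof (rule ge2.IH(1))
    have "graph_dist adj x0 x \<le> Suc (graph_dist adj x0 y)"
      using graph_dist_adj[OF conn] sym that by (blast dest: sympD)
    thus "R + t div 2 < graph_dist adj x0 y" using ge2.prems by simp
  qed
  hence neighbours: "(\<Sum>y | adj x y. U y t) = 0" by simp
  have "laplacian_ab adj q a b (\<lambda>y. U y t) x + time_diff2 (U x) t = 0"
    using sol by (simp add: wave_solution_def)
  thus ?case
    by (simp add: laplacian_ab_def laplacian_def time_diff2_def here neighbours)
qed

lemma wave_kernels_eq_0:
  assumes "tree adj" "regular_graph (q + 1) adj" "1 \<le> q" and r: "t div 2 < r"
  shows "wave_W adj x0 q a b r t = 0" and "wave_V adj x0 q a b r t = 0"
proof -
  obtain x where x: "graph_dist adj x0 x = r"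
    using sphere_nonempty[OF assms(1-3)] by blast
  have conn: "connected_graph adj" and sym: "symp adj"
    using assms(1) by (simp_all add: tree_def simple_graph_def)
  have far: "0 + t div 2 < graph_dist adj x0 x" using r x by simp
  have "vertex_W adj x0 q a b x t = 0"
    by (rule wave_solution_finite_speed[OF conn sym vertex_W_solution _ _ far])
       (simp_all add: delta_fun_radial[OF assms(1)])
  thus "wave_W adj x0 q a b r t = 0" by (simp add: wave_W_radial[OF assms(1-3)] x)
  have "vertex_V adj x0 q a b x t = 0"
    by (rule wave_solution_finite_speed[OF conn sym vertex_V_solution _ _ far])
       (simp_all add: delta_fun_radial[OF assms(1)])
  thus "wave_V adj x0 q a b r t = 0" by (simp add: wave_V_radial[OF assms(1-3)] x)
qed

theorem corollary6p1:
  fixes adj :: "'v \<Rightarrow> 'v \<Rightarrow> bool" and x0 :: 'v and q t :: nat and a b :: real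
  assumes "q \<ge> 1"
    and "tree adj" and "regular_graph (q + 1) adj"
    and "b \<noteq> 0"
    and "b * (real q + 1) - a \<ge> 2 * \<bar>b\<bar> * sqrt (real q)"
  shows "((\<lambda>r. wave_W adj x0 q a b r t) \<longlonglongrightarrow> 0) \<and>
         ((\<lambda>r. wave_V adj x0 q a b r t) \<longlonglongrightarrow> 0)"
proof
  have large: "\<forall>\<^sub>F r in sequentially. t div 2 < r" by (rule eventually_gt_at_top)
  note zero = wave_kernels_eq_0[OF assms(2,3,1)]
  show "(\<lambda>r. wave_W adj x0 q a b r t) \<longlonglongrightarrow> 0"
    by (rule tendsto_eventually, rule eventually_mono[OF large]) (rule zero(1))
  show "(\<lambda>r. wave_V adj x0 q a b r t) \<longlonglongrightarrow> 0"
    by (rule tendsto_eventually, rule eventually_mono[OF large]) (rule zero(2))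
qed

end
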